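(* For any non-trivial finite group $G$, the semigroup $\mathcal{S}(\partial\mathcal{C}(G))$ generated by the dual of the Cayley machine $\mathcal{C}(G)$ is free.
   Context: A transducer has a finite state set $Q$, a finite alphabet $A$, and for each state $q$ and letter $a$ exactly one edge $q\xrightarrow{a|b}p$ (input letter $a$, output letter $b$, next state $p$). Each state $q$ acts on $A^*$ letter by letter: on $a_1\ldots a_n$ it outputs $b$ where $q\xrightarrow{a_1|b}p$, and then $p$ acts on $a_2\ldots a_n$. The semigroup generated by these maps of $A^*$, over all states $q$, is $\mathcal{S}$ of the transducer. The dual $\partial\mathcal{A}$ of a transducer $\mathcal{A}$ with states $Q$ and alphabet $A$ has states $A$, alphabet $Q$, and an edge $a\xrightarrow{p|q}b$ for each edge $p\xrightarrow{a|b}q$ of $\mathcal{A}$. For a finite group $G$, the Cayley machine $\mathcal{C}(G)$ has state set $G$, alphabet $G$ and edges $g\xrightarrow{x|gx}gx$ for all $g,x\in G$; thus $\partial\mathcal{C}(G)$ has state set $G$, alphabet $G$ and edges $x\xrightarrow{g|gx}gx$ for all $g,x\in G$. *)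

theory Defs
  imports "HOL-Algebra.Group" "HOL-Library.FuncSet"
begin

text \<open>The unique edge leaving state \<open>q\<close> with input letter \<open>a\<close> has output letter \<open>out T q a\<close> and
  leads to \<open>step T q a\<close>. The values of \<open>out\<close> and \<open>step\<close> outside \<open>states T\<close> and \<open>alphabet T\<close>
  are irrelevant.\<close>

record ('q, 'a) transducer =
  states :: "'q set"
  alphabet :: "'a set"
  out :: "'q \<Rightarrow> 'a \<Rightarrow> 'a"
  step :: "'q \<Rightarrow> 'a \<Rightarrow> 'q"

definition is_transducer :: "('q, 'a) transducer \<Rightarrow> bool" where
  "is_transducer T \<longleftrightarrow> finite (states T) \<and> finite (alphabet T) \<and>
     (\<forall>q\<in>states T. \<forall>a\<in>alphabet T. out T q a \<in> alphabet T \<and> step T q a \<in> states T)"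

fun act :: "('q, 'a) transducer \<Rightarrow> 'q \<Rightarrow> 'a list \<Rightarrow> 'a list" where
  "act T q [] = []"
| "act T q (a # w) = out T q a # act T (step T q a) w"

text \<open>Maps of \<open>A\<^sup>*\<close> are represented as extensional functions on \<open>lists A\<close>, so that two of them are
  equal iff they agree on all words over the alphabet.\<close>

definition state_map :: "('q, 'a) transducer \<Rightarrow> 'q \<Rightarrow> 'a list \<Rightarrow> 'a list" where
  "state_map T q = restrict (act T q) (lists (alphabet T))"

abbreviation map_mult ::
  "('q, 'a) transducer \<Rightarrow> ('a list \<Rightarrow> 'a list) \<Rightarrow> ('a list \<Rightarrow> 'a list) \<Rightarrow> 'a list \<Rightarrow> 'a list" where
  "map_mult T \<equiv> compose (lists (alphabet T))"

inductive_set transducer_semigroup :: "('q, 'a) transducer \<Rightarrow> ('a list \<Rightarrow> 'a list) set"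
  for T :: "('q, 'a) transducer" where
  generator: "q \<in> states T \<Longrightarrow> state_map T q \<in> transducer_semigroup T"
| product: "f \<in> transducer_semigroup T \<Longrightarrow> g \<in> transducer_semigroup T \<Longrightarrow>
    map_mult T f g \<in> transducer_semigroup T"

definition dual :: "('q, 'a) transducer \<Rightarrow> ('a, 'q) transducer" where
  "dual T = \<lparr>states = alphabet T, alphabet = states T,
     out = (\<lambda>a p. step T p a), step = (\<lambda>a p. out T p a)\<rparr>"

definition cayley_machine :: "('g, 'm) monoid_scheme \<Rightarrow> ('g, 'g) transducer" where
  "cayley_machine G = \<lparr>states = carrier G, alphabet = carrier G,
     out = (\<lambda>g x. g \<otimes>\<^bsub>G\<^esub> x), step = (\<lambda>g x. g \<otimes>\<^bsub>G\<^esub> x)\<rparr>"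

definition nonempty_words :: "'x set \<Rightarrow> 'x list set" where
  "nonempty_words X = lists X - {[]}"

definition free_semigroup_iso ::
  "'x set \<Rightarrow> 's set \<Rightarrow> ('s \<Rightarrow> 's \<Rightarrow> 's) \<Rightarrow> ('x list \<Rightarrow> 's) \<Rightarrow> bool" where
  "free_semigroup_iso X S m \<phi> \<longleftrightarrow> bij_betw \<phi> (nonempty_words X) S \<and>
     (\<forall>u\<in>nonempty_words X. \<forall>v\<in>nonempty_words X. \<phi> (u @ v) = m (\<phi> u) (\<phi> v))"

text \<open>A semigroup is free if it is isomorphic to the semigroup of nonempty words over some set \<open>X\<close>.
  Taking \<open>X\<close> in the element type of the semigroup loses no generality, as shown by
  \<open>free_semigroup_if_iso\<close> below.\<close>

definition free_semigroup :: "'s set \<Rightarrow> ('s \<Rightarrow> 's \<Rightarrow> 's) \<Rightarrow> bool" where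
  "free_semigroup S m \<longleftrightarrow> (\<exists>(X :: 's set) \<phi>. free_semigroup_iso X S m \<phi>)"

lemma free_semigroup_if_iso:
  fixes X :: "'x set" and S :: "'s set"
  assumes "free_semigroup_iso X S m \<phi>"
  shows "free_semigroup S m"
proof -
  define i where "i = (\<lambda>x. \<phi> [x])"
  have inj: "inj_on \<phi> (nonempty_words X)"
    using assms by (simp add: free_semigroup_iso_def bij_betw_def)
  have "inj_on i X"
  proof (rule inj_onI)
    fix x y assume "x \<in> X" "y \<in> X" "i x = i y"
    then show "x = y"
      using inj_onD[OF inj, of "[x]" "[y]"] by (simp add: i_def nonempty_words_def)
  qed
  then have j: "bij_betw (inv_into X i) (i ` X) X"
    by (simp add: bij_betw_inv_into inj_on_imp_bij_betw)
  define \<psi> where "\<psi> = (\<lambda>w. \<phi> (map (inv_into X i) w))"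
  have "bij_betw (map (inv_into X i)) (lists (i ` X)) (lists X)"
    using j by (rule bij_lists)
  then have *: "bij_betw (map (inv_into X i)) (nonempty_words (i ` X)) (nonempty_words X)"
    unfolding nonempty_words_def bij_betw_def inj_on_def by auto
  have "bij_betw (\<phi> \<circ> map (inv_into X i)) (nonempty_words (i ` X)) S"
    using * assms unfolding free_semigroup_iso_def by (blast intro: bij_betw_trans)
  then have "bij_betw \<psi> (nonempty_words (i ` X)) S"
    by (simp add: \<psi>_def comp_def)
  with * have "free_semigroup_iso (i ` X) S m \<psi>"
    using assms unfolding free_semigroup_iso_def \<psi>_def by (auto dest: bij_betwE)
  then show ?thesis
    unfolding free_semigroup_def by blast
qed

lemma is_transducer_dual: "is_transducer T \<Longrightarrow> is_transducer (dual T)"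
  by (simp add: is_transducer_def dual_def)

lemma is_transducer_cayley_machine:
  "group G \<Longrightarrow> finite (carrier G) \<Longrightarrow> is_transducer (cayley_machine G)"
  by (simp add: is_transducer_def cayley_machine_def group.is_monoid monoid.m_closed)

end

theory Submission imports Defs begin

text \<open>
  Write \<open>f\<^sub>x\<close> for the map of state \<open>x\<close> of the dual of the Cayley machine. It sends
  \<open>g\<^sub>1 g\<^sub>2 g\<^sub>3 \<dots>\<close> to the word of accumulated products
  \<open>g\<^sub>1x, g\<^sub>2g\<^sub>1x, g\<^sub>3g\<^sub>2g\<^sub>1x, \<dots>\<close>. The semigroup is free on these maps. The key is to look at the
  inverse maps: \<open>f\<^sub>x\<close> is a permutation whose inverse takes successive quotients,
  \<open>h\<^sub>1 h\<^sub>2 h\<^sub>3 \<dots> \<mapsto> h\<^sub>1x\<inverse>, h\<^sub>2h\<^sub>1\<inverse>, h\<^sub>3h\<^sub>2\<inverse>, \<dots>\<close>, so that \<open>x\<close> enters only the first letter.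
  Consequently, if two words differ for the last time at position \<open>k\<close>, their images under inverses
  of any two generators, be they equal or not, differ for the last time at position \<open>k + 1\<close>
  (\<open>last_diff_fold_quotients\<close>). Iterating this decodes a composition of generators:

  \<^item> Its length can be read off. The word \<open>1 1 1 \<dots>\<close> is fixed by the inverse of \<open>f\<^sub>1\<close>, so comparing
    it with \<open>g 1 1 \<dots>\<close> for some \<open>g \<noteq> 1\<close> shows that undoing \<open>n\<close> generators on the latter yields a
    word whose last non-trivial letter stands at position \<open>n\<close>, counting from \<open>0\<close>
    (\<open>length_eq_if_fold_quotients_eq\<close>).

  \<^item> For two compositions of the same length, undoing different generators at the first place where
    they disagree creates two words that differ exactly at position \<open>0\<close>. By the shifting property
    this difference survives all later steps (\<open>eq_if_fold_quotients_eq\<close>).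

  Hence different nonempty words of generators define different maps.
\<close>

section \<open>Words of states as maps\<close>

definition word_map :: "('q, 'a) transducer \<Rightarrow> 'q list \<Rightarrow> 'a list \<Rightarrow> 'a list" where
  "word_map T u = restrict (foldr (act T) u) (lists (alphabet T))"

lemma act_in_lists:
  assumes "is_transducer T" "q \<in> states T" "w \<in> lists (alphabet T)"
  shows "act T q w \<in> lists (alphabet T)"
  using assms(3,2)
proof (induction w arbitrary: q)
  case (Cons a w)
  then show ?case
    using assms(1) by (auto simp: is_transducer_def)
qed simp

lemma foldr_act_in_lists:
  assumes "is_transducer T" "u \<in> lists (states T)" "w \<in> lists (alphabet T)"
  shows "foldr (act T) u w \<in> lists (alphabet T)"
  using assms(2) by induction (use assms(1,3) in \<open>simp_all add: act_in_lists del: in_lists_conv_set\<close>)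

lemma word_map_append:
  assumes "is_transducer T" "v \<in> lists (states T)"
  shows "word_map T (u @ v) = map_mult T (word_map T u) (word_map T v)"
  using foldr_act_in_lists[OF assms]
  by (auto simp: word_map_def compose_def fun_eq_iff)

lemma word_map_singleton: "word_map T [q] = state_map T q"
  by (simp add: word_map_def state_map_def)

lemma word_map_in_semigroup:
  assumes "is_transducer T" "u \<in> lists (states T)" "u \<noteq> []"
  shows "word_map T u \<in> transducer_semigroup T"
  using assms(2,3)
proof (induction u)
  case (Cons q u)
  show ?case
  proof (cases "u = []")
    case True
    then show ?thesis
      using Cons.hyps by (simp add: word_map_singleton transducer_semigroup.generator)
  next
    case False
    have "map_mult T (word_map T [q]) (word_map T u) \<in> transducer_semigroup T"
      unfolding word_map_singleton
      by (intro transducer_semigroup.intros Cons.hyps(1) Cons.IH False)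
    then show ?thesis
      using word_map_append[OF assms(1) Cons.hyps(2), of "[q]"] by simp
  qed
qed simp

lemma word_map_image_nonempty_words:
  assumes "is_transducer T"
  shows "word_map T ` nonempty_words (states T) = transducer_semigroup T"
proof
  show "word_map T ` nonempty_words (states T) \<subseteq> transducer_semigroup T"
    using word_map_in_semigroup[OF assms] by (auto simp: nonempty_words_def)
  show "transducer_semigroup T \<subseteq> word_map T ` nonempty_words (states T)"
  proof
    fix f assume "f \<in> transducer_semigroup T"
    then show "f \<in> word_map T ` nonempty_words (states T)"
    proof induction
      case (generator q)
      then show ?case
        by (auto simp: nonempty_words_def word_map_singleton intro!: image_eqI[of _ _ "[q]"])
    next
      case (product f g)
      then obtain u v
        where "u \<in> nonempty_words (states T)" "f = word_map T u"
          and "v \<in> nonempty_words (states T)" "g = word_map T v"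
        by blast
      then show ?case
        using word_map_append[OF assms, of v u]
        by (intro image_eqI[of _ _ "u @ v"]) (auto simp: nonempty_words_def)
    qed
  qed
qed

text \<open>Composition of generators always gives a homomorphism onto the semigroup, so freeness on the
  states comes down to injectivity.\<close>

lemma free_transducer_semigroup_if_inj:
  assumes "is_transducer T" "inj_on (word_map T) (nonempty_words (states T))"
  shows "free_semigroup (transducer_semigroup T) (map_mult T)"
proof (rule free_semigroup_if_iso)
  show "free_semigroup_iso (states T) (transducer_semigroup T) (map_mult T) (word_map T)"
    unfolding free_semigroup_iso_def bij_betw_def
  proof (intro conjI ballI)
    show "word_map T (u @ v) = map_mult T (word_map T u) (word_map T v)"
      if "v \<in> nonempty_words (states T)" for u v
      using that word_map_append[OF assms(1), of v u] by (simp add: nonempty_words_def)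
  qed (use assms word_map_image_nonempty_words in \<open>blast+\<close>)
qed


section \<open>Successive quotients\<close>

context group
begin

fun quotients :: "'a \<Rightarrow> 'a list \<Rightarrow> 'a list" where
  "quotients x [] = []"
| "quotients x (g # w) = g \<otimes> inv x # quotients g w"

lemma length_quotients [simp]: "length (quotients x w) = length w"
  by (induction w arbitrary: x) auto

lemma quotients_in_lists:
  "x \<in> carrier G \<Longrightarrow> w \<in> lists (carrier G) \<Longrightarrow> quotients x w \<in> lists (carrier G)"
  by (induction w arbitrary: x) auto

lemma length_fold_quotients [simp]: "length (fold quotients u w) = length w"
  by (induction u arbitrary: w) auto

lemma fold_quotients_in_lists:
  "u \<in> lists (carrier G) \<Longrightarrow> w \<in> lists (carrier G) \<Longrightarrow> fold quotients u w \<in> lists (carrier G)"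
  by (induction u arbitrary: w) (simp_all add: quotients_in_lists del: in_lists_conv_set)

lemma nth_quotients_Suc:
  "Suc k < length w \<Longrightarrow> quotients x w ! Suc k = w ! Suc k \<otimes> inv (w ! k)"
proof (induction w arbitrary: x k)
  case (Cons g w)
  then show ?case
    by (cases k; cases w) auto
qed simp

lemma act_quotients:
  "x \<in> carrier G \<Longrightarrow> w \<in> lists (carrier G) \<Longrightarrow>
    act (dual (cayley_machine G)) x (quotients x w) = w"
  by (induction w arbitrary: x) (auto simp: dual_def cayley_machine_def m_assoc)

lemma quotients_act:
  "x \<in> carrier G \<Longrightarrow> w \<in> lists (carrier G) \<Longrightarrow>
    quotients x (act (dual (cayley_machine G)) x w) = w"
  by (induction w arbitrary: x) (auto simp: dual_def cayley_machine_def m_assoc)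

text \<open>In a composition of maps the outermost one is undone first, hence \<open>foldr\<close> for the composition
  of the generators and \<open>fold\<close> for that of their inverses.\<close>

lemma foldr_act_fold_quotients:
  "u \<in> lists (carrier G) \<Longrightarrow> w \<in> lists (carrier G) \<Longrightarrow>
    foldr (act (dual (cayley_machine G))) u (fold quotients u w) = w"
  by (induction u arbitrary: w) (auto simp: act_quotients quotients_in_lists)

lemma fold_quotients_foldr_act:
  assumes "is_transducer (dual (cayley_machine G))"
    and "u \<in> lists (carrier G)" "w \<in> lists (carrier G)"
  shows "fold quotients u (foldr (act (dual (cayley_machine G))) u w) = w"
  using assms(2)
proof induction
  case (Cons x u)
  let ?T = "dual (cayley_machine G)"
  have "foldr (act ?T) u w \<in> lists (carrier G)"
    using foldr_act_in_lists[OF assms(1), of u w] Cons.hyps(2) assms(3)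
    by (simp add: dual_def cayley_machine_def)
  then show ?case
    using Cons by (simp add: quotients_act del: in_lists_conv_set)
qed simp


section \<open>The last difference of two words\<close>

definition last_diff :: "nat \<Rightarrow> 'c list \<Rightarrow> 'c list \<Rightarrow> bool" where
  "last_diff k v w \<longleftrightarrow> length v = length w \<and> k < length w \<and> v ! k \<noteq> w ! k \<and>
     (\<forall>j. k < j \<and> j < length w \<longrightarrow> v ! j = w ! j)"

lemma last_diff_unique:
  assumes "last_diff i v w" "last_diff j v w"
  shows "i = j"
  using assms unfolding last_diff_def by (metis linorder_neqE_nat)

text \<open>Letter \<open>k + 1\<close> of the new words is an equal letter divided by different ones; beyond it both
  numerators and denominators agree. The states \<open>x\<close> and \<open>y\<close> affect letter \<open>0\<close> only.\<close>

lemma last_diff_quotients: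
  assumes "last_diff k v w" "Suc k < length w"
    and "v \<in> lists (carrier G)" "w \<in> lists (carrier G)"
  shows "last_diff (Suc k) (quotients x v) (quotients y w)"
proof -
  have len: "length v = length w" and ne: "v ! k \<noteq> w ! k"
    and eq: "\<And>j. k < j \<Longrightarrow> j < length w \<Longrightarrow> v ! j = w ! j"
    using assms(1) by (auto simp: last_diff_def)
  have carr: "v ! j \<in> carrier G" "w ! j \<in> carrier G" if "j < length w" for j
    using assms(3,4) len that by (simp_all add: in_lists_conv_set)
  have "w ! Suc k \<otimes> inv (v ! k) \<noteq> w ! Suc k \<otimes> inv (w ! k)"
    using ne assms(2) carr[of k] carr[of "Suc k"] inv_inj
    by (auto simp: inj_on_def)
  then have "quotients x v ! Suc k \<noteq> quotients y w ! Suc k"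
    using assms(2) len eq by (simp add: nth_quotients_Suc)
  moreover have "quotients x v ! j = quotients y w ! j" if "Suc k < j" "j < length w" for j
    using that len eq by (cases j) (simp_all add: nth_quotients_Suc)
  ultimately show ?thesis
    using len assms(2) by (simp add: last_diff_def)
qed

lemma last_diff_fold_quotients:
  assumes "length s = length t"
    and "s \<in> lists (carrier G)" "t \<in> lists (carrier G)"
    and "last_diff k v w" "k + length s < length w"
    and "v \<in> lists (carrier G)" "w \<in> lists (carrier G)"
  shows "last_diff (k + length s) (fold quotients s v) (fold quotients t w)"
  using assms
proof (induction s t arbitrary: k v w rule: list_induct2)
  case (Cons x s y t)
  then have "last_diff (Suc k) (quotients x v) (quotients y w)"
    by (intro last_diff_quotients) auto
  with Cons have
    "last_diff (Suc k + length s) (fold quotients s (quotients x v)) (fold quotients t (quotients y w))"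
    by (intro Cons.IH) (simp_all add: quotients_in_lists del: in_lists_conv_set)
  then show ?case
    by simp
qed simp


section \<open>Decoding a composition of generators\<close>

lemma last_diff_fold_quotients_one:
  assumes "g \<in> carrier G" "g \<noteq> \<one>" "u \<in> lists (carrier G)" "length u \<le> n"
  shows "last_diff (length u) (fold quotients u (g # replicate n \<one>)) (replicate (Suc n) \<one>)"
proof -
  have "quotients \<one> (replicate m \<one>) = replicate m \<one>" for m
    by (induction m) auto
  then have ones: "fold quotients (replicate k \<one>) (replicate m \<one>) = replicate m \<one>" for k m
    by (induction k) auto
  have "last_diff 0 (g # replicate n \<one>) (replicate (Suc n) \<one>)"
    using assms(2) by (auto simp: last_diff_def nth_Cons split: nat.split)
  \<comment> \<open>The states of the second word are free to choose: with \<open>\<one>\<close> throughout, the constant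
      word does not move.\<close>
  then have "last_diff (0 + length u) (fold quotients u (g # replicate n \<one>))
      (fold quotients (replicate (length u) \<one>) (replicate (Suc n) \<one>))"
    using assms by (intro last_diff_fold_quotients) (auto simp: in_lists_conv_set)
  then show ?thesis
    unfolding ones by simp
qed

lemma length_eq_if_fold_quotients_eq:
  assumes "g \<in> carrier G" "g \<noteq> \<one>"
    and "u \<in> lists (carrier G)" "length u \<le> n" "v \<in> lists (carrier G)" "length v \<le> n"
    and "fold quotients u (g # replicate n \<one>) = fold quotients v (g # replicate n \<one>)"
  shows "length u = length v"
  using last_diff_fold_quotients_one[OF assms(1-4)] last_diff_fold_quotients_one[OF assms(1,2,5,6)]
  by (auto simp: assms(7) intro: last_diff_unique)

text \<open>If \<open>u\<close> and \<open>v\<close> first disagree with letters \<open>x \<noteq> y\<close>, then up to this place both act alike, and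
  \<open>x\<close> and \<open>y\<close> turn one and the same word into two words that differ at position \<open>0\<close> only. The length
  bound ensures that the remaining letters do not push this difference off the end.\<close>

lemma eq_if_fold_quotients_eq:
  assumes "length u = length v"
    and "u \<in> lists (carrier G)" "v \<in> lists (carrier G)"
    and "w \<in> lists (carrier G)" "length u \<le> length w"
    and "fold quotients u w = fold quotients v w"
  shows "u = v"
  using assms
proof (induction u v arbitrary: w rule: list_induct2)
  case (Cons x u y v)
  have carr: "x \<in> carrier G" "y \<in> carrier G" "u \<in> lists (carrier G)" "v \<in> lists (carrier G)"
    using Cons.prems by auto
  have "x = y"
  proof (rule ccontr)
    assume "x \<noteq> y"
    obtain g w' where w: "w = g # w'"
      using Cons.prems(4) by (cases w) auto
    have "g \<otimes> inv x \<noteq> g \<otimes> inv y"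
      using \<open>x \<noteq> y\<close> carr w Cons.prems(3) inv_inj by (auto simp: inj_on_def)
    then have "last_diff 0 (quotients x w) (quotients y w)"
      by (auto simp: w last_diff_def nth_Cons split: nat.split)
    then have "last_diff (0 + length u) (fold quotients u (quotients x w))
        (fold quotients v (quotients y w))"
      using Cons.prems Cons.hyps carr
      by (intro last_diff_fold_quotients quotients_in_lists) auto
    then show False
      using Cons.prems(5) by (simp add: last_diff_def)
  qed
  moreover have "u = v"
    using Cons.prems carr \<open>x = y\<close>
    by (intro Cons.IH[of "quotients x w"] quotients_in_lists) auto
  ultimately show ?case
    by simp
qed simp

lemma inj_on_word_map_dual_cayley_machine:
  assumes "is_transducer (dual (cayley_machine G))" "carrier G \<noteq> {\<one>}"
  shows "inj_on (word_map (dual (cayley_machine G))) (lists (carrier G))"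
proof (rule inj_onI)
  let ?T = "dual (cayley_machine G)"
  fix u v
  assume u: "u \<in> lists (carrier G)" and v: "v \<in> lists (carrier G)"
    and eq: "word_map ?T u = word_map ?T v"
  obtain g where g: "g \<in> carrier G" "g \<noteq> \<one>"
    using assms(2) by blast
  define n where "n = max (length u) (length v)"
  define z where "z = g # replicate n \<one>"
  have z: "z \<in> lists (carrier G)"
    using g by (auto simp: z_def in_lists_conv_set)
  define w where "w = fold quotients u z"
  have w: "w \<in> lists (carrier G)"
    unfolding w_def using u z by (rule fold_quotients_in_lists)
  \<comment> \<open>Equal bijections have equal inverses; it is enough to compare the inverses on \<open>z\<close>.\<close>
  have "foldr (act ?T) v w = foldr (act ?T) u w"
    using fun_cong[OF eq, of w] w by (simp add: word_map_def dual_def cayley_machine_def)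
  also have "\<dots> = z"
    unfolding w_def using u z by (rule foldr_act_fold_quotients)
  finally have "fold quotients v z = w"
    using fold_quotients_foldr_act[OF assms(1) v w] by simp
  then have fold_eq: "fold quotients u z = fold quotients v z"
    by (simp add: w_def)
  have "length u = length v"
    by (rule length_eq_if_fold_quotients_eq[OF g u _ v, of n])
      (use fold_eq in \<open>simp_all add: z_def n_def\<close>)
  then show "u = v"
    by (rule eq_if_fold_quotients_eq[OF _ u v z _ fold_eq]) (simp add: z_def n_def)
qed

end

theorem theorem5:
  fixes G :: "('g, 'm) monoid_scheme"
  assumes "group G" and "finite (carrier G)" and "carrier G \<noteq> {\<one>\<^bsub>G\<^esub>}"
  shows "free_semigroup (transducer_semigroup (dual (cayley_machine G)))
           (map_mult (dual (cayley_machine G)))"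
proof (rule free_transducer_semigroup_if_inj)
  show T: "is_transducer (dual (cayley_machine G))"
    using assms by (intro is_transducer_dual is_transducer_cayley_machine)
  show "inj_on (word_map (dual (cayley_machine G)))
      (nonempty_words (states (dual (cayley_machine G))))"
    using group.inj_on_word_map_dual_cayley_machine[OF assms(1) T assms(3)]
    by (rule inj_on_subset) (auto simp: nonempty_words_def dual_def cayley_machine_def)
qed

end
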